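(* Let $P$ and $Q$ be probability distributions on a measurable space $(\mathcal{X},\mathcal{F})$. For any $\alpha\in[0,\infty]$ $$D_\alpha(P\|Q)=\sup_{\mathcal{P}}D_\alpha(P_{|\mathcal{P}}\|Q_{|\mathcal{P}}),$$ where the supremum is over all finite partitions $\mathcal{P}\subseteq\mathcal{F}$ of $\mathcal{X}$.
   Context: For a finite partition $\mathcal{P}\subseteq\mathcal{F}$ of $\mathcal{X}$, $P_{|\mathcal{P}}$ denotes the restriction of $P$ to the $\sigma$-algebra $\sigma(\mathcal{P})$ generated by $\mathcal{P}$, and similarly for $Q$. Rényi divergence: let $P,Q$ be probability distributions on a measurable space with densities $p,q$ with respect to a dominating $\sigma$-finite measure $\mu$ (whose choice is immaterial). For $\alpha\in(0,1)\cup(1,\infty)$, $D_\alpha(P\|Q)=\frac{1}{\alpha-1}\ln\int p^\alpha q^{1-\alpha}\,d\mu\in[0,\infty]$, where for $\alpha>1$ one reads $p^\alpha q^{1-\alpha}$ as $p^\alpha/q^{\alpha-1}$ with the conventions $0/0=0$ and $x/0=\infty$ for $x>0$. Further $D_0(P\|Q)=\lim_{\alpha\downarrow0}D_\alpha(P\|Q)$, $D_1(P\|Q)=\lim_{\alpha\uparrow1}D_\alpha(P\|Q)$ and $D_\infty(P\|Q)=\lim_{\alpha\uparrow\infty}D_\alpha(P\|Q)$ (these limits always exist in $[0,\infty]$). *)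

theory Defs
  imports "HOL-Probability.Probability"
begin

definition ln_ennreal :: "ennreal \<Rightarrow> ereal" where
  "ln_ennreal x = (if x = 0 then -\<infinity> else if x = \<infinity> then \<infinity> else ereal (ln (enn2real x)))"

(* Division on ennreal satisfies 0 / 0 = 0 and x / 0 = \<infinity> for x > 0. *)
definition renyi_integrand :: "real \<Rightarrow> real \<Rightarrow> real \<Rightarrow> ennreal" where
  "renyi_integrand a u v =
     (if a < 1 then ennreal (u powr a * v powr (1 - a))
      else ennreal (u powr a) / ennreal (v powr (a - 1)))"

(* For densities p, q with respect to M and a simple order a in (0,1) or (1,\<infinity>). *)
definition renyi_divergence_density ::
    "real \<Rightarrow> 'a measure \<Rightarrow> ('a \<Rightarrow> real) \<Rightarrow> ('a \<Rightarrow> real) \<Rightarrow> ereal" where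
  "renyi_divergence_density a M p q =
     ereal (1 / (a - 1)) * ln_ennreal (\<integral>\<^sup>+x. renyi_integrand a (p x) (q x) \<partial>M)"

definition sum_measure :: "'a measure \<Rightarrow> 'a measure \<Rightarrow> 'a measure" where
  "sum_measure P Q = measure_of (space P) (sets P) (\<lambda>A. emeasure P A + emeasure Q A)"

(* The dominating measure is fixed to be P + Q; lemma renyi_divergence_simple_eq_density below
   shows that any other dominating measure gives the same value. *)
definition renyi_divergence_simple :: "real \<Rightarrow> 'a measure \<Rightarrow> 'a measure \<Rightarrow> ereal" where
  "renyi_divergence_simple a P Q =
     renyi_divergence_density a (sum_measure P Q)
       (\<lambda>x. enn2real (RN_deriv (sum_measure P Q) P x))
       (\<lambda>x. enn2real (RN_deriv (sum_measure P Q) Q x))"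

definition renyi_divergence :: "ennreal \<Rightarrow> 'a measure \<Rightarrow> 'a measure \<Rightarrow> ereal" where
  "renyi_divergence \<alpha> P Q =
     (if \<alpha> = 0 then Lim (at_right 0) (\<lambda>a. renyi_divergence_simple a P Q)
      else if \<alpha> = 1 then Lim (at_left 1) (\<lambda>a. renyi_divergence_simple a P Q)
      else if \<alpha> = \<infinity> then Lim at_top (\<lambda>a. renyi_divergence_simple a P Q)
      else renyi_divergence_simple (enn2real \<alpha>) P Q)"

definition finite_measurable_partitions :: "'a measure \<Rightarrow> 'a set set set" where
  "finite_measurable_partitions M = {\<P>. finite \<P> \<and> \<P> \<subseteq> sets M \<and> partition_on (space M) \<P>}"

definition restrict_to_partition :: "'a measure \<Rightarrow> 'a set set \<Rightarrow> 'a measure" where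
  "restrict_to_partition P \<P> = restr_to_subalg P (sigma (space P) \<P>)"

lemma space_sum_measure [simp]: "space (sum_measure P Q) = space P"
  by (simp add: sum_measure_def space_measure_of_conv)

lemma sets_sum_measure [simp, measurable_cong]: "sets (sum_measure P Q) = sets P"
  by (simp add: sum_measure_def)

lemma emeasure_sum_measure:
  assumes "sets P = sets Q" "A \<in> sets P"
  shows "emeasure (sum_measure P Q) A = emeasure P A + emeasure Q A"
  unfolding sum_measure_def
proof (rule emeasure_measure_of_sigma)
  show "sigma_algebra (space P) (sets P)" by (rule sets.sigma_algebra_axioms)
  show "positive (sets P) (\<lambda>A. emeasure P A + emeasure Q A)" by (simp add: positive_def)
  show "countably_additive (sets P) (\<lambda>A. emeasure P A + emeasure Q A)"
  proof (rule countably_additiveI)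
    fix A :: "nat \<Rightarrow> 'a set"
    assume A: "range A \<subseteq> sets P" "disjoint_family A"
    have "(\<Sum>i. emeasure P (A i) + emeasure Q (A i)) =
        (\<Sum>i. emeasure P (A i)) + (\<Sum>i. emeasure Q (A i))"
      by (intro suminf_add[symmetric] summableI)
    also have "\<dots> = emeasure P (\<Union>i. A i) + emeasure Q (\<Union>i. A i)"
      using A assms(1) by (simp add: suminf_emeasure)
    finally show "(\<Sum>i. emeasure P (A i) + emeasure Q (A i)) =
        emeasure P (\<Union>i. A i) + emeasure Q (\<Union>i. A i)" .
  qed
qed fact

lemma measurable_renyi_integrand [measurable]:
  assumes [measurable]: "f \<in> borel_measurable M" "g \<in> borel_measurable M"
  shows "(\<lambda>x. renyi_integrand a (f x) (g x)) \<in> borel_measurable M"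
  unfolding renyi_integrand_def by measurable

lemma renyi_integrand_scale:
  assumes "u \<ge> 0" "v \<ge> 0" "s > 0" "a > 0" "a \<noteq> 1"
  shows "ennreal s * renyi_integrand a (u / s) (v / s) = renyi_integrand a u v"
proof (cases "a < 1")
  case True
  have "s * ((u / s) powr a * (v / s) powr (1 - a)) =
      s * (u powr a * v powr (1 - a)) / (s powr a * s powr (1 - a))"
    using assms by (simp add: powr_divide)
  also have "s powr a * s powr (1 - a) = s"
    using assms by (simp flip: powr_add)
  finally show ?thesis
    using True assms by (simp add: renyi_integrand_def flip: ennreal_mult)
next
  case False
  then have a: "a > 1" using assms by simp
  consider "u = 0" | "u > 0" "v = 0" | "u > 0" "v > 0" using assms by linarith
  then show ?thesis
  proof cases
    case 1
    then show ?thesis using a by (simp add: renyi_integrand_def)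
  next
    case 2
    then show ?thesis
      using a assms by (simp add: renyi_integrand_def ennreal_divide_zero ennreal_mult_top)
  next
    case 3
    have s: "s powr a = s * s powr (a - 1)"
      using assms powr_add[of s 1 "a - 1"] by simp
    have "s * ((u / s) powr a / (v / s) powr (a - 1)) = u powr a / v powr (a - 1)"
      using assms 3 by (simp add: powr_divide s field_simps)
    then show ?thesis
      using a assms 3 by (simp add: renyi_integrand_def divide_ennreal flip: ennreal_mult)
  qed
qed

lemma renyi_divergence_simple_eq_density:
  assumes P: "prob_space P" and Q: "prob_space Q"
    and M: "sigma_finite_measure M"
    and [measurable]: "p \<in> borel_measurable M" "q \<in> borel_measurable M"
    and nonneg: "\<And>x. x \<in> space M \<Longrightarrow> p x \<ge> 0" "\<And>x. x \<in> space M \<Longrightarrow> q x \<ge> 0"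
    and dens: "P = density M (\<lambda>x. ennreal (p x))" "Q = density M (\<lambda>x. ennreal (q x))"
    and a: "a > 0" "a \<noteq> 1"
  shows "renyi_divergence_simple a P Q = renyi_divergence_density a M p q"
proof -
  interpret M: sigma_finite_measure M by fact
  define S where "S = sum_measure P Q"
  have sets: "sets P = sets M" "sets Q = sets M" by (simp_all add: dens)
  have setsS: "sets S = sets M" by (simp add: S_def sets)
  have emS: "emeasure S A = emeasure P A + emeasure Q A" if "A \<in> sets M" for A
    using that by (simp add: S_def emeasure_sum_measure sets)
  have S_eq: "S = density M (\<lambda>x. ennreal (p x) + ennreal (q x))"
  proof (rule measure_eqI)
    fix A assume "A \<in> sets S"
    then have A: "A \<in> sets M" by (simp add: setsS)
    show "emeasure S A = emeasure (density M (\<lambda>x. ennreal (p x) + ennreal (q x))) A"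
      using A emS[OF A] by (simp add: dens emeasure_density_add)
  qed (simp add: setsS)
  have fin: "finite_measure S"
  proof (rule finite_measureI)
    have "space S \<in> sets M" using setsS by auto
    then show "emeasure S (space S) \<noteq> \<infinity>"
      using finite_measure.emeasure_finite[OF prob_space.finite_measure[OF P]]
        finite_measure.emeasure_finite[OF prob_space.finite_measure[OF Q]]
      by (simp add: emS)
  qed
  interpret S: finite_measure S by fact
  have [measurable]: "RN_deriv S N \<in> borel_measurable M" for N
    using borel_measurable_RN_deriv[of S N] measurable_cong_sets[OF setsS refl] by blast
  have ae: "AE x in M. (ennreal (p x) + ennreal (q x)) * RN_deriv S N x = ennreal (r x)"
    if N: "N = density M (\<lambda>x. ennreal (r x))" and [measurable]: "r \<in> borel_measurable M"
      and le: "\<And>A. A \<in> sets M \<Longrightarrow> emeasure N A \<le> emeasure S A" for N r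
  proof -
    have setsN: "sets N = sets M" by (simp add: N)
    have ac: "absolutely_continuous S N"
      using le by (auto simp: absolutely_continuous_def null_sets_def setsS setsN
          simp flip: le_zero_eq) fastforce
    have "density M (\<lambda>x. (ennreal (p x) + ennreal (q x)) * RN_deriv S N x) =
        density S (RN_deriv S N)"
      unfolding S_eq[symmetric] by (subst S_eq, subst density_density_eq) simp_all
    also have "\<dots> = N"
      using ac by (intro S.density_RN_deriv) (simp_all add: setsS setsN)
    finally show ?thesis
      unfolding N by (intro M.density_unique) (simp_all add: N)
  qed
  have aeP: "AE x in M. (ennreal (p x) + ennreal (q x)) * RN_deriv S P x = ennreal (p x)"
    by (rule ae) (simp_all add: dens(1) emS[unfolded dens(1)])
  have aeQ: "AE x in M. (ennreal (p x) + ennreal (q x)) * RN_deriv S Q x = ennreal (q x)"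
    by (rule ae) (simp_all add: dens(2) emS[unfolded dens(2)])
  have "(\<integral>\<^sup>+x. renyi_integrand a (enn2real (RN_deriv S P x)) (enn2real (RN_deriv S Q x)) \<partial>S) =
      (\<integral>\<^sup>+x. (ennreal (p x) + ennreal (q x)) *
         renyi_integrand a (enn2real (RN_deriv S P x)) (enn2real (RN_deriv S Q x)) \<partial>M)"
    using nn_integral_density[of "\<lambda>x. ennreal (p x) + ennreal (q x)" M
        "\<lambda>x. renyi_integrand a (enn2real (RN_deriv S P x)) (enn2real (RN_deriv S Q x))"]
    by (simp flip: S_eq)
  also have "\<dots> = (\<integral>\<^sup>+x. renyi_integrand a (p x) (q x) \<partial>M)"
  proof (rule nn_integral_cong_AE)
    have quot: "enn2real d = w / s" if "ennreal s * d = ennreal w" "s > 0" "w \<ge> 0"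
      for s w :: real and d
    proof -
      have "enn2real (ennreal s * d) = w" unfolding that(1) using that(3) by simp
      then have "s * enn2real d = w" using that(2) by (simp add: enn2real_mult)
      then show ?thesis using that by (simp add: field_simps)
    qed
    show "AE x in M. (ennreal (p x) + ennreal (q x)) *
         renyi_integrand a (enn2real (RN_deriv S P x)) (enn2real (RN_deriv S Q x)) =
       renyi_integrand a (p x) (q x)"
      using aeP aeQ AE_space
    proof eventually_elim
      case (elim x)
      have pq: "p x \<ge> 0" "q x \<ge> 0" using nonneg elim by auto
      then have sum: "ennreal (p x) + ennreal (q x) = ennreal (p x + q x)" by simp
      show ?case
      proof (cases "p x + q x = 0")
        case True
        then have "p x = 0" "q x = 0" using pq by auto
        then show ?thesis by (simp add: renyi_integrand_def)
      next
        case False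
        then have s: "p x + q x > 0" using pq by auto
        have "enn2real (RN_deriv S P x) = p x / (p x + q x)"
          "enn2real (RN_deriv S Q x) = q x / (p x + q x)"
          using elim pq s unfolding sum by (auto intro!: quot)
        then show ?thesis
          unfolding sum using renyi_integrand_scale[of "p x" "q x" "p x + q x" a] pq s a by simp
      qed
    qed
  qed
  finally show ?thesis
    by (simp add: renyi_divergence_simple_def renyi_divergence_density_def flip: S_def)
qed

end

theory Submission
  imports Defs
begin

text \<open>
  Let \<open>S\<close> be the sum of \<open>P\<close> and \<open>Q\<close>, and \<open>f\<close> the density of \<open>P\<close> with respect to \<open>S\<close>,
  so that \<open>1 - f\<close> is the density of \<open>Q\<close>. For a simple order, Hoelder's inequality on each cell shows
  that a partition can only decrease the divergence. Conversely, on the level sets of \<open>f\<close> of height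
  \<open>1 / n\<close> the cell averages of the densities converge to \<open>f\<close> and \<open>1 - f\<close>, and the integrals converge
  by dominated convergence (order below 1) or by Fatou's lemma (order above 1).
  The divergence increases in the order, so at orders 1 and \<open>\<infinity>\<close> it is a supremum over simple
  orders, which commutes with the supremum over partitions. At order 0 it is an infimum; there a
  single partition, into the support of \<open>f\<close> and its complement, attains the value \<open>- ln Q(f > 0)\<close>.
\<close>

subsection \<open>Hoelder's inequality and its consequences for the integrand\<close>

text \<open>Young's inequality; at a zero argument the left side is 0 because
  \<open>0 powr r = 0\<close>.\<close>

lemma powr_mult_powr_le_convex_sum:
  fixes x y t :: real
  assumes "0 < t" "t < 1" "x \<ge> 0" "y \<ge> 0"
  shows "x powr t * y powr (1 - t) \<le> t * x + (1 - t) * y"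
proof (cases "x = 0 \<or> y = 0")
  case False
  then show ?thesis using Youngs_inequality_0[of t "1 - t" x y] assms by simp
qed (use assms in auto)

text \<open>Young's inequality for \<open>u / U\<close> and \<open>v / V\<close>, integrated. The
  integrals are only assumed to lie below \<open>U\<close> and \<open>V\<close>, so that estimates
  can be inserted directly.\<close>

lemma nn_integral_Hoelder:
  fixes u v :: "'a \<Rightarrow> real"
  assumes t: "0 < t" "t < 1"
    and [measurable]: "u \<in> borel_measurable M" "v \<in> borel_measurable M"
    and nonneg: "\<And>x. u x \<ge> 0" "\<And>x. v x \<ge> 0"
    and U: "(\<integral>\<^sup>+x. ennreal (u x) \<partial>M) \<le> ennreal U" "U \<ge> 0"
    and V: "(\<integral>\<^sup>+x. ennreal (v x) \<partial>M) \<le> ennreal V" "V \<ge> 0"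
  shows "(\<integral>\<^sup>+x. ennreal (u x powr t * v x powr (1 - t)) \<partial>M) \<le> ennreal (U powr t * V powr (1 - t))"
\<comment> \<open>Division by \<open>U\<close> and \<open>V\<close> is impossible if one of them is
  0; then one factor, and with it the product, vanishes almost everywhere.\<close>
proof (cases "U = 0 \<or> V = 0")
  case True
  moreover have "ennreal (u x) = 0 \<longleftrightarrow> u x = 0" "ennreal (v x) = 0 \<longleftrightarrow> v x = 0" for x
    using nonneg[of x] by (auto simp: ennreal_eq_0_iff)
  ultimately have "(AE x in M. u x = 0) \<or> (AE x in M. v x = 0)"
    using U V by (auto simp: nn_integral_0_iff_AE)
  then have "AE x in M. u x powr t * v x powr (1 - t) = 0"
    by auto
  then have "(\<integral>\<^sup>+x. ennreal (u x powr t * v x powr (1 - t)) \<partial>M) = 0"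
    by (subst nn_integral_0_iff_AE) (auto elim: eventually_mono)
  then show ?thesis by simp
next
  case False
  then have pos: "U > 0" "V > 0" using U V by auto
  let ?c = "U powr t * V powr (1 - t)"
  have c: "?c > 0" using pos by simp
  have le: "u x powr t * v x powr (1 - t) \<le> ?c * t / U * u x + ?c * (1 - t) / V * v x" for x
  proof -
    have "u x powr t * v x powr (1 - t) = ?c * ((u x / U) powr t * (v x / V) powr (1 - t))"
      using pos nonneg by (simp add: powr_divide)
    also have "\<dots> \<le> ?c * (t * (u x / U) + (1 - t) * (v x / V))"
      using t pos nonneg c by (intro mult_left_mono powr_mult_powr_le_convex_sum) auto
    finally show ?thesis by (simp add: algebra_simps)
  qed
  have "(\<integral>\<^sup>+x. ennreal (u x powr t * v x powr (1 - t)) \<partial>M)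
      \<le> (\<integral>\<^sup>+x. ennreal (?c * t / U) * ennreal (u x) + ennreal (?c * (1 - t) / V) * ennreal (v x) \<partial>M)"
    using t pos nonneg c le
    by (intro nn_integral_mono) (simp flip: ennreal_mult ennreal_plus)
  also have "\<dots> = ennreal (?c * t / U) * (\<integral>\<^sup>+x. ennreal (u x) \<partial>M)
      + ennreal (?c * (1 - t) / V) * (\<integral>\<^sup>+x. ennreal (v x) \<partial>M)"
    by (simp add: nn_integral_add nn_integral_cmult)
  also have "\<dots> \<le> ennreal (?c * t / U) * ennreal U + ennreal (?c * (1 - t) / V) * ennreal V"
    by (intro add_mono mult_left_mono U V) auto
  also have "\<dots> = ennreal ?c"
  proof -
    have "?c * t / U * U + ?c * (1 - t) / V * V = ?c"
      using pos by (simp add: right_diff_distrib)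
    then show ?thesis
      using t pos by (simp flip: ennreal_mult ennreal_plus)
  qed
  finally show ?thesis .
qed

text \<open>For \<open>a > 1\<close> and \<open>u > 0\<close> the two sides differ at
  \<open>v = 0\<close>: the quotient is infinite, whereas \<open>0 powr (1 - a) = 0\<close> makes
  the product 0.\<close>

lemma renyi_integrand_eq_powr:
  assumes "a < 1 \<or> v > 0" "a \<noteq> 1" "u \<ge> 0"
  shows "renyi_integrand a u v = ennreal (u powr a * v powr (1 - a))"
proof (cases "a < 1")
  case False
  then have "v > 0" using assms by auto
  then show ?thesis
    using False powr_minus[of v "a - 1"]
    by (simp add: renyi_integrand_def divide_ennreal) (simp add: field_simps)
qed (simp add: renyi_integrand_def)

lemma renyi_integrand_zero_left [simp]: "renyi_integrand a 0 v = 0"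
  by (simp add: renyi_integrand_def)

lemma renyi_integrand_zero_right:
  assumes "a > 1" "u > 0"
  shows "renyi_integrand a u 0 = \<infinity>"
  using assms by (simp add: renyi_integrand_def ennreal_divide_zero)

text \<open>A finite integral confines the infinite values of the integrand, taken where
  \<open>p x > 0\<close> and \<open>q x = 0\<close>, to a null set. Off it real powers can be
  multiplied freely.\<close>

lemma AE_renyi_integrand_eq_powr:
  assumes a: "a > 1"
    and [measurable]: "p \<in> borel_measurable M" "q \<in> borel_measurable M"
    and nonneg: "\<And>x. p x \<ge> 0" "\<And>x. q x \<ge> 0"
    and fin: "(\<integral>\<^sup>+x. renyi_integrand a (p x) (q x) \<partial>M) \<noteq> \<infinity>"
  shows "AE x in M. (p x = 0 \<or> q x > 0) \<and>
    renyi_integrand a (p x) (q x) = ennreal (p x powr a * q x powr (1 - a))"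
proof -
  have "AE x in M. renyi_integrand a (p x) (q x) \<noteq> \<infinity>"
    using fin by (intro nn_integral_PInf_AE) auto
  then show ?thesis
  proof eventually_elim
    case (elim x)
    have "p x = 0 \<or> q x > 0"
      using elim a nonneg[of x] renyi_integrand_zero_right[of a "p x"]
      by (cases "q x = 0"; cases "p x = 0") auto
    then show ?case
      using a nonneg[of x] renyi_integrand_eq_powr[of a "q x" "p x"] by auto
  qed
qed

text \<open>Hoelder's inequality with \<open>t = a\<close>; applied below to the whole space and to
  the cells of a partition.\<close>

lemma nn_integral_renyi_integrand_le:
  assumes a: "0 < a" "a < 1"
    and [measurable]: "p \<in> borel_measurable M" "q \<in> borel_measurable M"
    and nonneg: "\<And>x. p x \<ge> 0" "\<And>x. q x \<ge> 0"
    and "(\<integral>\<^sup>+x. ennreal (p x) \<partial>M) = ennreal u" "(\<integral>\<^sup>+x. ennreal (q x) \<partial>M) = ennreal v"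
    and "u \<ge> 0" "v \<ge> 0"
  shows "(\<integral>\<^sup>+x. renyi_integrand a (p x) (q x) \<partial>M) \<le> renyi_integrand a u v"
  using nn_integral_Hoelder[of a p M q u v] assms by (simp add: renyi_integrand_def)

text \<open>With \<open>w = p^a q^(1-a)\<close> one has \<open>p = w^(1/a) q^(1-1/a)\<close> almost
  everywhere. Hoelder's inequality with \<open>t = 1 / a\<close>, raised to the power
  \<open>a\<close>, bounds the integral of \<open>w\<close> from below.\<close>

lemma nn_integral_renyi_integrand_ge:
  assumes a: "a > 1"
    and [measurable]: "p \<in> borel_measurable M" "q \<in> borel_measurable M"
    and nonneg: "\<And>x. p x \<ge> 0" "\<And>x. q x \<ge> 0"
    and p: "(\<integral>\<^sup>+x. ennreal (p x) \<partial>M) = ennreal u" and q: "(\<integral>\<^sup>+x. ennreal (q x) \<partial>M) = ennreal v"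
    and uv: "u \<ge> 0" "v \<ge> 0"
  shows "(\<integral>\<^sup>+x. renyi_integrand a (p x) (q x) \<partial>M) \<ge> renyi_integrand a u v"
proof (cases "(\<integral>\<^sup>+x. renyi_integrand a (p x) (q x) \<partial>M)")
  case (real j)
  have AE: "AE x in M. (p x = 0 \<or> q x > 0) \<and>
      renyi_integrand a (p x) (q x) = ennreal (p x powr a * q x powr (1 - a))"
    using a nonneg real by (intro AE_renyi_integrand_eq_powr) auto
  let ?w = "\<lambda>x. p x powr a * q x powr (1 - a)"
  have w: "(\<integral>\<^sup>+x. ennreal (?w x) \<partial>M) = ennreal j"
    using AE by (subst real(2)[symmetric], intro nn_integral_cong_AE) auto
  \<comment> \<open>The total exponent of \<open>q x\<close> in the Hoelder product is 0, which
    leaves \<open>p x\<close> alone.\<close>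
  have e: "(1 - a) * (1 / a) + (1 - 1 / a) = 0" using a by (simp add: field_simps)
  have "ennreal u = (\<integral>\<^sup>+x. ennreal (?w x powr (1 / a) * q x powr (1 - 1 / a)) \<partial>M)"
    unfolding p[symmetric]
  proof (intro nn_integral_cong_AE, use AE in eventually_elim)
    case (elim x)
    then show ?case
      using a nonneg[of x] e
      by (auto simp: powr_mult powr_powr mult.assoc simp flip: powr_add)
  qed
  also have "\<dots> \<le> ennreal (j powr (1 / a) * v powr (1 - 1 / a))"
    using a nonneg real q uv w by (intro nn_integral_Hoelder) auto
  finally have le: "u \<le> j powr (1 / a) * v powr (1 - 1 / a)"
    using real by (simp add: ennreal_le_iff)
  show ?thesis
  proof (cases "u = 0")
    case False
    then have u: "u > 0" using uv by simp
    \<comment> \<open>With \<open>v = 0\<close> the bound \<open>le\<close> would read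
      \<open>u \<le> 0\<close>.\<close>
    then have v: "v > 0" using le uv by (cases "v = 0") auto
    have "u powr a \<le> (j powr (1 / a) * v powr (1 - 1 / a)) powr a"
      using a uv le by (intro powr_mono2) auto
    also have "\<dots> = j * v powr (a - 1)"
      using a real v by (simp add: powr_mult powr_powr left_diff_distrib)
    finally have "u powr a / v powr (a - 1) \<le> j"
      using v by (simp add: field_simps)
    then show ?thesis
      using a v real by (simp add: renyi_integrand_def divide_ennreal ennreal_leI)
  qed simp
qed simp

text \<open>With \<open>t = (1 - b) / (1 - a)\<close> the order \<open>b\<close> equals
  \<open>a * t + 1 * (1 - t)\<close>, so its integrand interpolates between that of order
  \<open>a\<close> and \<open>p\<close> itself, whose integral is 1.\<close>

lemma nn_integral_renyi_integrand_le_powr: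
  assumes ab: "0 < a" "a < b" "b < 1"
    and [measurable]: "p \<in> borel_measurable M" "q \<in> borel_measurable M"
    and nonneg: "\<And>x. p x \<ge> 0" "\<And>x. q x \<ge> 0"
    and p: "(\<integral>\<^sup>+x. ennreal (p x) \<partial>M) = 1"
    and j: "(\<integral>\<^sup>+x. renyi_integrand a (p x) (q x) \<partial>M) = ennreal j" "j \<ge> 0"
  shows "(\<integral>\<^sup>+x. renyi_integrand b (p x) (q x) \<partial>M) \<le> ennreal (j powr ((1 - b) / (1 - a)))"
proof -
  let ?t = "(1 - b) / (1 - a)"
  let ?w = "\<lambda>x. p x powr a * q x powr (1 - a)"
  have t: "0 < ?t" "?t < 1" using ab by simp_all
  have e2: "(1 - a) * ?t = 1 - b" using ab by simp
  have "a * x + (1 - x) = 1 - (1 - a) * x" for x by (simp add: algebra_simps)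
  from this[of ?t] have e1: "a * ?t + (1 - ?t) = b" unfolding e2 by simp
  have "(\<integral>\<^sup>+x. renyi_integrand b (p x) (q x) \<partial>M)
      = (\<integral>\<^sup>+x. ennreal (?w x powr ?t * p x powr (1 - ?t)) \<partial>M)"
  proof (intro nn_integral_cong)
    fix x
    have "?w x powr ?t * p x powr (1 - ?t) = p x powr (a * ?t + (1 - ?t)) * q x powr ((1 - a) * ?t)"
      unfolding powr_add by (simp add: powr_mult powr_powr nonneg)
    then show "renyi_integrand b (p x) (q x) = ennreal (?w x powr ?t * p x powr (1 - ?t))"
      unfolding e1 e2 using ab by (simp add: renyi_integrand_def)
  qed
  also have "\<dots> \<le> ennreal (j powr ?t * 1 powr (1 - ?t))"
    using ab j p nonneg by (intro nn_integral_Hoelder t) (auto simp: renyi_integrand_def)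
  finally show ?thesis by simp
qed

text \<open>Here \<open>a\<close> lies between 1 and \<open>b\<close>, so the interpolation is
  between \<open>p\<close> and the integrand of order \<open>b\<close>, with weight
  \<open>(a - 1) / (b - 1)\<close> on the latter.\<close>

lemma nn_integral_renyi_integrand_le_powr':
  assumes ab: "1 < a" "a < b"
    and [measurable]: "p \<in> borel_measurable M" "q \<in> borel_measurable M"
    and nonneg: "\<And>x. p x \<ge> 0" "\<And>x. q x \<ge> 0"
    and p: "(\<integral>\<^sup>+x. ennreal (p x) \<partial>M) = 1"
    and j: "(\<integral>\<^sup>+x. renyi_integrand b (p x) (q x) \<partial>M) = ennreal j" "j \<ge> 0"
  shows "(\<integral>\<^sup>+x. renyi_integrand a (p x) (q x) \<partial>M) \<le> ennreal (j powr ((a - 1) / (b - 1)))"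
proof -
  let ?t = "(a - 1) / (b - 1)"
  let ?w = "\<lambda>x. p x powr b * q x powr (1 - b)"
  have t: "0 < ?t" "?t < 1" using ab by simp_all
  have e2: "(1 - b) * ?t = 1 - a"
    using ab minus_mult_left[of "b - 1" ?t] by simp
  have "b * x + (1 - x) = 1 - (1 - b) * x" for x by (simp add: algebra_simps)
  from this[of ?t] have e1: "b * ?t + (1 - ?t) = a" unfolding e2 by simp
  have AE: "AE x in M. (p x = 0 \<or> q x > 0) \<and>
      renyi_integrand b (p x) (q x) = ennreal (p x powr b * q x powr (1 - b))"
    using ab nonneg j by (intro AE_renyi_integrand_eq_powr) auto
  have "(\<integral>\<^sup>+x. renyi_integrand a (p x) (q x) \<partial>M)
      = (\<integral>\<^sup>+x. ennreal (?w x powr ?t * p x powr (1 - ?t)) \<partial>M)"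
  proof (intro nn_integral_cong_AE, use AE in eventually_elim)
    case (elim x)
    have "?w x powr ?t * p x powr (1 - ?t) = p x powr (b * ?t + (1 - ?t)) * q x powr ((1 - b) * ?t)"
      unfolding powr_add by (simp add: powr_mult powr_powr nonneg)
    then show ?case
      unfolding e1 e2 using ab elim nonneg[of x] renyi_integrand_eq_powr[of a "q x" "p x"] by auto
  qed
  also have "\<dots> \<le> ennreal (j powr ?t * 1 powr (1 - ?t))"
  proof (intro nn_integral_Hoelder t)
    show "(\<integral>\<^sup>+x. ennreal (?w x) \<partial>M) \<le> ennreal j"
      using AE by (subst j(1)[symmetric], intro nn_integral_mono_AE) auto
  qed (use nonneg p j in auto)
  finally show ?thesis by simp
qed

subsection \<open>The logarithm on the extended half-line\<close>

lemma ln_ennreal_ennreal: "x > 0 \<Longrightarrow> ln_ennreal (ennreal x) = ereal (ln x)"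
  by (simp add: ln_ennreal_def)

lemma ln_ennreal_0 [simp]: "ln_ennreal 0 = -\<infinity>"
  and ln_ennreal_top [simp]: "ln_ennreal top = \<infinity>"
  by (simp_all add: ln_ennreal_def)

lemma ln_ennreal_mono: 
  assumes "x \<le> y" shows "ln_ennreal x \<le> ln_ennreal y"
proof (cases "x = 0 \<or> y = top")
  case True
  then show ?thesis by auto
next
  case False
  then obtain r s where "x = ennreal r" "y = ennreal s" "r \<ge> 0" "s \<ge> 0"
    using assms by (cases x; cases y) (auto simp: top_unique)
  then show ?thesis
    using False assms by (simp add: ln_ennreal_ennreal order_less_le)
qed

text \<open>A monotone map with open range is continuous for the order topologies, and every
  extended real is a logarithm.\<close>

lemma continuous_on_ln_ennreal: "continuous_on UNIV ln_ennreal"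
proof (rule continuous_onI_mono)
  have "y \<in> range ln_ennreal" for y
  proof (cases y)
    case (real r)
    then have "ln_ennreal (ennreal (exp r)) = y" by (simp add: ln_ennreal_ennreal)
    then show ?thesis by blast
  next
    case PInf
    then show ?thesis using ln_ennreal_top by (metis rangeI)
  next
    case MInf
    then show ?thesis using ln_ennreal_0 by (metis rangeI)
  qed
  then have "range ln_ennreal = UNIV" by auto
  then show "open (range ln_ennreal)" by simp
qed (rule ln_ennreal_mono)

lemma tendsto_ln_ennreal:
  assumes "(f \<longlongrightarrow> l) F" shows "((\<lambda>x. ln_ennreal (f x)) \<longlongrightarrow> ln_ennreal l) F"
  by (rule continuous_on_tendsto_compose[OF continuous_on_ln_ennreal assms]) auto

lemma cmult_ln_ennreal_antimono:
  assumes "a < 1" "x \<le> y"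
  shows "ereal (1 / (a - 1)) * ln_ennreal y \<le> ereal (1 / (a - 1)) * ln_ennreal x"
proof -
  have "1 / (a - 1) = - (1 / (1 - a))"
    using assms by (simp add: field_simps)
  then have *: "ereal (1 / (a - 1)) = - ereal (1 / (1 - a))" by simp
  have "ereal (1 / (1 - a)) * ln_ennreal x \<le> ereal (1 / (1 - a)) * ln_ennreal y"
    by (rule ereal_mult_left_mono[OF ln_ennreal_mono]) (use assms in simp_all)
  then show ?thesis unfolding * ereal_mult_minus_left ereal_minus_le_minus .
qed

lemma cmult_ln_ennreal_mono:
  assumes "a > 1" "x \<le> y"
  shows "ereal (1 / (a - 1)) * ln_ennreal x \<le> ereal (1 / (a - 1)) * ln_ennreal y"
  by (rule ereal_mult_left_mono[OF ln_ennreal_mono]) (use assms in simp_all)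

subsection \<open>Densities with respect to the sum of the two distributions\<close>

text \<open>One function carries both densities, since they add up to 1; thus \<open>S\<close> is
  the sum of the two distributions. The bounds on \<open>f\<close> hold at every point, which keeps
  real powers tame and makes the constant 1 a dominating function.\<close>

locale mixture_density = S: finite_measure S + P: prob_space P + Q: prob_space Q
  for S P Q :: "'a measure" +
  fixes f :: "'a \<Rightarrow> real"
  assumes measurable_f [measurable]: "f \<in> borel_measurable S"
    and f_nonneg: "f x \<ge> 0" and f_le_1: "f x \<le> 1"
    and P_eq: "P = density S (\<lambda>x. ennreal (f x))"
    and Q_eq: "Q = density S (\<lambda>x. ennreal (1 - f x))"

lemma mixture_density_exists:
  assumes P: "prob_space P" and Q: "prob_space Q" and sets: "sets P = sets Q"
  obtains S f where "mixture_density S P Q f"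
proof -
  interpret P: prob_space P by fact
  interpret Q: prob_space Q by fact
  define S where "S = sum_measure P Q"
  have setsS: "sets S = sets P" by (simp add: S_def)
  have emS: "emeasure S A = emeasure P A + emeasure Q A" if "A \<in> sets S" for A
    using that by (simp add: S_def emeasure_sum_measure sets)
  have spQ: "space Q = space P" using sets by (rule sets_eq_imp_space_eq[symmetric])
  have "emeasure S (space S) = 1 + 1"
    using emS[OF sets.top] P.emeasure_space_1 Q.emeasure_space_1 spQ by (simp add: S_def)
  then interpret S: finite_measure S by (intro finite_measureI) simp
  have "absolutely_continuous S P" "absolutely_continuous S Q"
    by (auto simp: absolutely_continuous_def null_sets_def emS setsS sets)
  then have dP: "density S (RN_deriv S P) = P" and dQ: "density S (RN_deriv S Q) = Q"
    using setsS sets by (auto intro!: S.density_RN_deriv)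
  \<comment> \<open>Both sides represent \<open>S\<close>, so uniqueness of densities shows that the
    two derivatives add up to 1 almost everywhere.\<close>
  have "density S (\<lambda>x. RN_deriv S P x + RN_deriv S Q x) = density S (\<lambda>_. 1)"
  proof (rule measure_eqI)
    fix A assume "A \<in> sets (density S (\<lambda>x. RN_deriv S P x + RN_deriv S Q x))"
    then have A: "A \<in> sets S" by simp
    then show "emeasure (density S (\<lambda>x. RN_deriv S P x + RN_deriv S Q x)) A =
        emeasure (density S (\<lambda>_. 1)) A"
      by (subst emeasure_density_add[symmetric]) (simp_all add: dP dQ emS density_1)
  qed simp
  then have AE1: "AE x in S. RN_deriv S P x + RN_deriv S Q x = 1"
    by (intro S.density_unique) auto
  \<comment> \<open>Taking \<open>min 1\<close> secures the upper bound at every point and changes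
    the derivative only on a null set.\<close>
  define f where "f x = min 1 (enn2real (RN_deriv S P x))" for x
  have AE: "AE x in S. RN_deriv S P x = ennreal (f x) \<and> RN_deriv S Q x = ennreal (1 - f x)"
    using AE1
  proof eventually_elim
    case (elim x)
    then obtain r s where rs: "RN_deriv S P x = ennreal r" "RN_deriv S Q x = ennreal s"
      "r \<ge> 0" "s \<ge> 0"
      by (cases "RN_deriv S P x"; cases "RN_deriv S Q x") auto
    then have "r + s = 1" using elim by (simp flip: ennreal_plus)
    then have "s = 1 - r" "r \<le> 1" using rs by auto
    then show ?case using rs by (simp add: f_def)
  qed
  have "mixture_density S P Q f"
  proof
    show [measurable]: "f \<in> borel_measurable S" unfolding f_def by measurable
    show "f x \<ge> 0" "f x \<le> 1" for x by (simp_all add: f_def)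
    show "P = density S (\<lambda>x. ennreal (f x))"
      by (subst dP[symmetric], rule density_cong) (use AE in auto)
    show "Q = density S (\<lambda>x. ennreal (1 - f x))"
      by (subst dQ[symmetric], rule density_cong) (use AE in auto)
  qed
  then show ?thesis by (rule that)
qed

context mixture_density
begin

lemma sets_P: "sets P = sets S" and sets_Q: "sets Q = sets S"
  by (simp_all add: P_eq Q_eq)

lemma space_P: "space P = space S" and space_Q: "space Q = space S"
  by (simp_all add: P_eq Q_eq)

lemma emeasure_P: "A \<in> sets S \<Longrightarrow> emeasure P A = (\<integral>\<^sup>+x. ennreal (f x) * indicator A x \<partial>S)"
  unfolding P_eq by (rule emeasure_density) auto

lemma emeasure_Q: "A \<in> sets S \<Longrightarrow> emeasure Q A = (\<integral>\<^sup>+x. ennreal (1 - f x) * indicator A x \<partial>S)"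
  unfolding Q_eq by (rule emeasure_density) auto

lemma measure_add:
  assumes A: "A \<in> sets S"
  shows "measure P A + measure Q A = measure S A"
proof -
  have "emeasure P A + emeasure Q A
      = (\<integral>\<^sup>+x. ennreal (f x) * indicator A x + ennreal (1 - f x) * indicator A x \<partial>S)"
    using A unfolding emeasure_P[OF A] emeasure_Q[OF A] by (subst nn_integral_add) auto
  also have "\<dots> = (\<integral>\<^sup>+x. indicator A x \<partial>S)"
    by (intro nn_integral_cong)
      (auto simp: f_nonneg f_le_1 simp flip: ennreal_plus split: split_indicator)
  finally show ?thesis
    using A by (simp add: P.emeasure_eq_measure Q.emeasure_eq_measure S.emeasure_eq_measure
        flip: ennreal_plus)
qed

text \<open>The Hellinger integral of order \<open>a\<close>; it may be infinite for
  \<open>a > 1\<close>.\<close>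

definition renyi_integral :: "real \<Rightarrow> ennreal" where
  "renyi_integral a = (\<integral>\<^sup>+x. renyi_integrand a (f x) (1 - f x) \<partial>S)"

lemma renyi_divergence_simple_eq:
  assumes "a > 0" "a \<noteq> 1"
  shows "renyi_divergence_simple a P Q = ereal (1 / (a - 1)) * ln_ennreal (renyi_integral a)"
proof -
  have "renyi_divergence_simple a P Q = renyi_divergence_density a S f (\<lambda>x. 1 - f x)"
    by (rule renyi_divergence_simple_eq_density[OF P.prob_space_axioms Q.prob_space_axioms
        S.sigma_finite_measure_axioms _ _ _ _ P_eq Q_eq])
      (use assms in \<open>simp_all add: f_nonneg f_le_1\<close>)
  then show ?thesis by (simp add: renyi_divergence_density_def renyi_integral_def)
qed

section \<open>Monotonicity of the divergence in its order\<close>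

lemma nn_integral_f: "(\<integral>\<^sup>+x. ennreal (f x) \<partial>S) = 1"
  using emeasure_P[OF sets.top] P.emeasure_space_1 unfolding space_P
  by (simp cong: nn_integral_cong_simp)

lemma nn_integral_1_minus_f: "(\<integral>\<^sup>+x. ennreal (1 - f x) \<partial>S) = 1"
  using emeasure_Q[OF sets.top] Q.emeasure_space_1 unfolding space_Q
  by (simp cong: nn_integral_cong_simp)

lemma renyi_integral_le_1:
  assumes "0 < a" "a < 1" shows "renyi_integral a \<le> 1"
  using nn_integral_renyi_integrand_le[of a f S "\<lambda>x. 1 - f x" 1 1] assms
    nn_integral_f nn_integral_1_minus_f f_nonneg f_le_1
  by (simp add: renyi_integral_def renyi_integrand_def)

text \<open>Take logarithms in the Hoelder bound. Multiplication by \<open>1 / (b - 1) < 0\<close>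
  reverses it and turns the exponent \<open>(1 - b) / (1 - a)\<close> into the factor
  \<open>1 / (a - 1)\<close>.\<close>

lemma renyi_divergence_simple_mono_less_1:
  assumes ab: "0 < a" "a \<le> b" "b < 1"
  shows "renyi_divergence_simple a P Q \<le> renyi_divergence_simple b P Q"
proof (cases "a = b")
  case False
  with ab have less: "a < b" by simp
  obtain j where j: "renyi_integral a = ennreal j" "j \<ge> 0"
    using renyi_integral_le_1[of a] ab by (cases "renyi_integral a") (auto simp: top_unique)
  have le: "renyi_integral b \<le> ennreal (j powr ((1 - b) / (1 - a)))"
    using nn_integral_renyi_integrand_le_powr[of a b f S "\<lambda>x. 1 - f x" j]
      ab less j nn_integral_f f_nonneg f_le_1 by (simp add: renyi_integral_def)
  have D: "renyi_divergence_simple b P Q \<ge>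
      ereal (1 / (b - 1)) * ln_ennreal (ennreal (j powr ((1 - b) / (1 - a))))"
    using ab less le by (subst renyi_divergence_simple_eq) (auto intro: cmult_ln_ennreal_antimono)
  show ?thesis
  proof (cases "j = 0")
    \<comment> \<open>The bound forces the integral at order \<open>b\<close> to vanish as well, so
      the divergence there is infinite.\<close>
    case True
    then show ?thesis using D ab by (simp add: zero_less_divide_iff)
  next
    case False
    then have "j > 0" using j by simp
    moreover have "1 / (b - 1) * ((1 - b) / (1 - a) * ln j) = 1 / (a - 1) * ln j"
      using ab less by (simp add: divide_simps) (simp add: algebra_simps)
    ultimately show ?thesis
      using D ab less j by (subst renyi_divergence_simple_eq) (auto simp: ln_ennreal_ennreal ln_powr)
  qed
qed simp

text \<open>Now the factor \<open>1 / (a - 1)\<close> is positive and turns the exponent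
  \<open>(a - 1) / (b - 1)\<close> into \<open>1 / (b - 1)\<close>. An infinite integral at order
  \<open>b\<close> makes the right side infinite.\<close>

lemma renyi_divergence_simple_mono_greater_1:
  assumes ab: "1 < a" "a \<le> b"
  shows "renyi_divergence_simple a P Q \<le> renyi_divergence_simple b P Q"
proof (cases "a = b")
  case False
  with ab have less: "a < b" by simp
  show ?thesis
  proof (cases "renyi_integral b")
    case (real j)
    have le: "renyi_integral a \<le> ennreal (j powr ((a - 1) / (b - 1)))"
      using nn_integral_renyi_integrand_le_powr'[of a b f S "\<lambda>x. 1 - f x" j]
        ab less real nn_integral_f f_nonneg f_le_1 by (simp add: renyi_integral_def)
    have D: "renyi_divergence_simple a P Q \<le>
        ereal (1 / (a - 1)) * ln_ennreal (ennreal (j powr ((a - 1) / (b - 1))))"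
      using ab less le by (subst renyi_divergence_simple_eq) (auto intro: cmult_ln_ennreal_mono)
    show ?thesis
    proof (cases "j = 0")
      case True
      then show ?thesis using D ab by simp
    next
      case False
      then have "j > 0" using real by simp
      moreover have "1 / (a - 1) * ((a - 1) / (b - 1) * ln j) = 1 / (b - 1) * ln j"
        using ab less by (simp add: divide_simps)
      ultimately show ?thesis
        using D ab less real
        by (subst (2) renyi_divergence_simple_eq) (auto simp: ln_ennreal_ennreal ln_powr)
    qed
  next
    case top
    then show ?thesis using ab less by (subst (2) renyi_divergence_simple_eq) auto
  qed
qed simp

end

subsection \<open>Limits of the divergence in its order\<close>

text \<open>Monotonicity is asked only on the open interval beside the limit point, because the
  divergence is known to be monotone on each side of order 1 separately. The two variants below
  follow the same pattern.\<close>

lemma tendsto_SUP_at_left: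
  fixes g :: "real \<Rightarrow> ereal"
  assumes "x < y" "\<And>a b. x < a \<Longrightarrow> a \<le> b \<Longrightarrow> b < y \<Longrightarrow> g a \<le> g b"
  shows "(g \<longlongrightarrow> (SUP a\<in>{x<..<y}. g a)) (at_left y)"
proof (rule order_tendstoI)
  fix c assume "c < (SUP a\<in>{x<..<y}. g a)"
  then obtain a where a: "x < a" "a < y" "c < g a" by (auto simp: less_SUP_iff)
  then have "eventually (\<lambda>b. b \<in> {a<..<y}) (at_left y)"
    by (intro eventually_at_leftI) auto
  then show "eventually (\<lambda>b. c < g b) (at_left y)"
  proof eventually_elim
    case (elim b)
    then have "g a \<le> g b" using a by (intro assms(2)) auto
    then show ?case using a by simp
  qed
next
  fix c assume c: "c > (SUP a\<in>{x<..<y}. g a)"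
  have "eventually (\<lambda>b. b \<in> {x<..<y}) (at_left y)"
    using assms by (intro eventually_at_leftI) auto
  then show "eventually (\<lambda>b. g b < c) (at_left y)"
    by eventually_elim (rule le_less_trans[OF SUP_upper c], simp)
qed

lemma tendsto_INF_at_right:
  fixes g :: "real \<Rightarrow> ereal"
  assumes "x < y" "\<And>a b. x < a \<Longrightarrow> a \<le> b \<Longrightarrow> b < y \<Longrightarrow> g a \<le> g b"
  shows "(g \<longlongrightarrow> (INF a\<in>{x<..<y}. g a)) (at_right x)"
proof (rule order_tendstoI)
  fix c assume "c > (INF a\<in>{x<..<y}. g a)"
  then obtain b where b: "x < b" "b < y" "g b < c" by (auto simp: INF_less_iff)
  then have "eventually (\<lambda>a. a \<in> {x<..<b}) (at_right x)"
    by (intro eventually_at_rightI) auto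
  then show "eventually (\<lambda>a. g a < c) (at_right x)"
  proof eventually_elim
    case (elim a)
    then have "g a \<le> g b" using b by (intro assms(2)) auto
    then show ?case using b by simp
  qed
next
  fix c assume c: "c < (INF a\<in>{x<..<y}. g a)"
  have "eventually (\<lambda>b. b \<in> {x<..<y}) (at_right x)"
    using assms by (intro eventually_at_rightI) auto
  then show "eventually (\<lambda>b. c < g b) (at_right x)"
    by eventually_elim (rule less_le_trans[OF c INF_lower])
qed

lemma tendsto_SUP_at_top:
  fixes g :: "real \<Rightarrow> ereal"
  assumes "\<And>a b. x < a \<Longrightarrow> a \<le> b \<Longrightarrow> g a \<le> g b"
  shows "(g \<longlongrightarrow> (SUP a\<in>{x<..}. g a)) at_top"
proof (rule order_tendstoI)
  fix c assume "c < (SUP a\<in>{x<..}. g a)"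
  then obtain a where a: "x < a" "c < g a" by (auto simp: less_SUP_iff)
  show "eventually (\<lambda>b. c < g b) at_top"
    using eventually_ge_at_top[of a]
  proof eventually_elim
    case (elim b)
    then have "g a \<le> g b" using a by (intro assms) auto
    then show ?case using a by simp
  qed
next
  fix c assume c: "c > (SUP a\<in>{x<..}. g a)"
  show "eventually (\<lambda>b. g b < c) at_top"
    using eventually_gt_at_top[of x]
    by eventually_elim (rule le_less_trans[OF SUP_upper c], simp)
qed

context
  fixes P Q :: "'a measure"
  assumes PQ: "prob_space P" "prob_space Q" "sets P = sets Q"
begin

text \<open>Monotonicity in the order replaces the limit by an infimum. This lemma and its two
  companions stand outside the locale so that they also apply to the restrictions to a
  partition.\<close>

lemma renyi_divergence_0_eq_INF:
  "renyi_divergence 0 P Q = (INF a\<in>{0<..<1}. renyi_divergence_simple a P Q)"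
proof -
  obtain S f where "mixture_density S P Q f" using PQ by (rule mixture_density_exists)
  then show ?thesis
    by (simp add: renyi_divergence_def tendsto_Lim[OF _ tendsto_INF_at_right]
        mixture_density.renyi_divergence_simple_mono_less_1)
qed

lemma renyi_divergence_1_eq_SUP:
  "renyi_divergence 1 P Q = (SUP a\<in>{0<..<1}. renyi_divergence_simple a P Q)"
proof -
  obtain S f where "mixture_density S P Q f" using PQ by (rule mixture_density_exists)
  then show ?thesis
    by (simp add: renyi_divergence_def tendsto_Lim[OF _ tendsto_SUP_at_left]
        mixture_density.renyi_divergence_simple_mono_less_1)
qed

lemma renyi_divergence_top_eq_SUP:
  "renyi_divergence top P Q = (SUP a\<in>{1<..}. renyi_divergence_simple a P Q)"
proof -
  obtain S f where "mixture_density S P Q f" using PQ by (rule mixture_density_exists)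
  then show ?thesis
    by (simp add: renyi_divergence_def tendsto_Lim[OF _ tendsto_SUP_at_top]
        mixture_density.renyi_divergence_simple_mono_greater_1)
qed

end

subsection \<open>Restriction to finite partitions\<close>

text \<open>On cells of positive \<open>S\<close>-measure this is the average of the density of
  \<open>N\<close> with respect to \<open>S\<close>, a conditional expectation given the partition.
  On \<open>S\<close>-null cells division by zero makes it 0.\<close>

definition cell_density :: "'a measure \<Rightarrow> 'a measure \<Rightarrow> 'a set set \<Rightarrow> 'a \<Rightarrow> real" where
  "cell_density S N \<P> x = (\<Sum>A\<in>\<P>. indicator A x * (measure N A / measure S A))"

lemma partition_on_cell_unique:
  assumes "partition_on X \<P>" "A \<in> \<P>" "x \<in> A" "B \<in> \<P>"
  shows "x \<in> B \<longleftrightarrow> B = A"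
  using assms by (auto simp: partition_on_def disjoint_def)

lemma cell_density_eq:
  assumes "finite \<P>" "partition_on X \<P>" "A \<in> \<P>" "x \<in> A"
  shows "cell_density S N \<P> x = measure N A / measure S A"
proof -
  have "cell_density S N \<P> x = (\<Sum>B\<in>\<P>. if B = A then measure N A / measure S A else 0)"
    unfolding cell_density_def
    using partition_on_cell_unique[OF assms(2-4)]
    by (intro sum.cong) (auto simp: indicator_def)
  then show ?thesis using assms by simp
qed

lemma cell_density_nonneg: "cell_density S N \<P> x \<ge> 0"
  unfolding cell_density_def by (intro sum_nonneg) auto

lemma nn_integral_partition:
  assumes "finite \<P>" "\<P> \<subseteq> sets M" and part: "partition_on (space M) \<P>"
    and [measurable]: "h \<in> borel_measurable M"
  shows "(\<integral>\<^sup>+x. h x \<partial>M) = (\<Sum>A\<in>\<P>. \<integral>\<^sup>+x. h x * indicator A x \<partial>M)"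
proof -
  have "(\<integral>\<^sup>+x. h x \<partial>M) = (\<integral>\<^sup>+x. (\<Sum>A\<in>\<P>. h x * indicator A x) \<partial>M)"
  proof (rule nn_integral_cong)
    fix x assume "x \<in> space M"
    then obtain A where A: "A \<in> \<P>" "x \<in> A" using part by (auto simp: partition_on_def)
    have "(\<Sum>B\<in>\<P>. h x * indicator B x) = (\<Sum>B\<in>\<P>. if B = A then h x else 0)"
      using partition_on_cell_unique[OF part A] by (intro sum.cong) (auto simp: indicator_def)
    then show "h x = (\<Sum>A\<in>\<P>. h x * indicator A x)" using assms A by simp
  qed
  also have "\<dots> = (\<Sum>A\<in>\<P>. \<integral>\<^sup>+x. h x * indicator A x \<partial>M)"
    using assms(2) by (intro nn_integral_sum) (auto intro!: borel_measurable_times_ennreal)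
  finally show ?thesis .
qed

lemma subalgebra_sigma_partition:
  assumes "\<P> \<subseteq> sets M"
  shows "subalgebra M (sigma (space M) \<P>)"
proof -
  have "\<P> \<subseteq> Pow (space M)" using assms sets.sets_into_space by blast
  then show ?thesis
    using assms by (simp add: subalgebra_def sets.sigma_sets_subset)
qed

lemma measurable_cell_density_sigma:
  assumes "\<P> \<subseteq> sets M"
  shows "cell_density S N \<P> \<in> borel_measurable (sigma (space M) \<P>)"
proof -
  have "\<P> \<subseteq> Pow (space M)" using assms sets.sets_into_space by blast
  then have "A \<in> sets (sigma (space M) \<P>)" if "A \<in> \<P>" for A
    using that by (simp add: sigma_sets.Basic)
  then show ?thesis unfolding cell_density_def
    by (intro borel_measurable_sum borel_measurable_times borel_measurable_indicator) auto
qed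

text \<open>The cells together with the empty set form an intersection-stable generator, so
  agreement of the two measures on cells suffices. The assumption \<open>null\<close> is absolute
  continuity on the cells.\<close>

lemma restr_to_subalg_partition_eq_density:
  assumes S: "finite_measure S" and N: "finite_measure N" and sets: "sets N = sets S"
    and \<P>: "finite \<P>" "\<P> \<subseteq> sets S" "partition_on (space S) \<P>"
    and null: "\<And>A. A \<in> \<P> \<Longrightarrow> measure S A = 0 \<Longrightarrow> measure N A = 0"
  defines "F \<equiv> sigma (space S) \<P>"
  shows "restr_to_subalg N F = density (restr_to_subalg S F) (\<lambda>x. ennreal (cell_density S N \<P> x))"
    (is "_ = ?D")
proof -
  interpret S: finite_measure S by fact
  interpret N: finite_measure N by fact
  have sp: "space N = space S" using sets by (rule sets_eq_imp_space_eq)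
  have subS: "subalgebra S F" unfolding F_def using \<P>(2) by (rule subalgebra_sigma_partition)
  then have subN: "subalgebra N F" by (simp add: subalgebra_def sets sp)
  have Pow: "\<P> \<subseteq> Pow (space S)" using \<P>(2) sets.sets_into_space by blast
  have setsF: "sets F = sigma_sets (space S) (insert {} \<P>)"
    unfolding F_def using Pow
    by (subst sets_measure_of) (auto intro!: sigma_sets_eqI simp: sigma_sets.Empty)
  have in_F: "A \<in> sets F" if "A \<in> \<P>" for A
    unfolding setsF using that by (auto intro: sigma_sets.Basic)
  have [measurable]: "cell_density S N \<P> \<in> borel_measurable F"
    unfolding F_def by (rule measurable_cell_density_sigma) fact
  have eq: "emeasure (restr_to_subalg N F) A = emeasure ?D A" if A: "A \<in> \<P>" for A
  proof -
    have [measurable]: "A \<in> sets F" using A by (rule in_F)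
    have AS: "A \<in> sets S" using A \<P> by auto
    have "emeasure ?D A
        = (\<integral>\<^sup>+x. ennreal (cell_density S N \<P> x) * indicator A x \<partial>restr_to_subalg S F)"
      using subS by (subst emeasure_density)
        (auto simp: sets_restr_to_subalg intro!: measurable_in_subalg)
    also have "\<dots> = (\<integral>\<^sup>+x. ennreal (cell_density S N \<P> x) * indicator A x \<partial>S)"
      by (rule nn_integral_subalgebra2[OF subS]) measurable
    also have "\<dots> = (\<integral>\<^sup>+x. ennreal (measure N A / measure S A) * indicator A x \<partial>S)"
      using cell_density_eq[OF \<P>(1,3) A]
      by (intro nn_integral_cong) (auto split: split_indicator)
    also have "\<dots> = ennreal (measure N A / measure S A) * emeasure S A"
      using AS by (rule nn_integral_cmult_indicator)
    also have "\<dots> = ennreal (measure N A)"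
      using null[OF A] by (cases "measure S A = 0")
        (auto simp: S.emeasure_eq_measure simp flip: ennreal_mult)
    also have "\<dots> = emeasure (restr_to_subalg N F) A"
      by (simp add: emeasure_restr_to_subalg[OF subN] N.emeasure_eq_measure)
    finally show ?thesis ..
  qed
  show ?thesis
  proof (rule measure_eqI_generator_eq_countable)
    show "Int_stable (insert {} \<P>)"
    proof (rule Int_stableI)
      fix A B assume "A \<in> insert {} \<P>" "B \<in> insert {} \<P>"
      then show "A \<inter> B \<in> insert {} \<P>"
        using \<P>(3) by (cases "A = B") (auto simp: partition_on_def disjoint_def)
    qed
    show "insert {} \<P> \<subseteq> Pow (space S)" using Pow by auto
    show "emeasure (restr_to_subalg N F) A = emeasure ?D A" if "A \<in> insert {} \<P>" for A
      using that eq by auto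
    show "sets (restr_to_subalg N F) = sigma_sets (space S) (insert {} \<P>)"
      "sets ?D = sigma_sets (space S) (insert {} \<P>)"
      using subN subS by (simp_all add: sets_restr_to_subalg setsF)
    show "\<P> \<subseteq> insert {} \<P>" "\<Union>\<P> = space S" "countable \<P>"
      using \<P> by (auto simp: partition_on_def countable_finite)
    show "emeasure (restr_to_subalg N F) A \<noteq> \<infinity>" if "A \<in> \<P>" for A
      using that by (simp add: emeasure_restr_to_subalg[OF subN] in_F)
  qed
qed

section \<open>Divergence of the restrictions as a sum over cells\<close>

context mixture_density
begin

lemma measure_P_eq_0: "A \<in> sets S \<Longrightarrow> measure S A = 0 \<Longrightarrow> measure P A = 0"
  and measure_Q_eq_0: "A \<in> sets S \<Longrightarrow> measure S A = 0 \<Longrightarrow> measure Q A = 0"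
  using measure_add[of A] measure_nonneg[of P A] measure_nonneg[of Q A] by linarith+

lemma finite_measurable_partitionsD:
  assumes "\<P> \<in> finite_measurable_partitions P"
  shows "finite \<P>" "\<P> \<subseteq> sets S" "partition_on (space S) \<P>"
  using assms by (auto simp: finite_measurable_partitions_def sets_P space_P)

text \<open>The integrand is measurable for the sigma-algebra of the partition, so integrating over
  the restricted \<open>S\<close> or over \<open>S\<close> itself gives the same value. This
  integral form serves the limit argument, the sum form below serves the comparison.\<close>

lemma renyi_divergence_simple_partition_eq_step:
  assumes a: "a > 0" "a \<noteq> 1" and \<P>: "\<P> \<in> finite_measurable_partitions P"
  shows "renyi_divergence_simple a (restrict_to_partition P \<P>) (restrict_to_partition Q \<P>)
    = ereal (1 / (a - 1)) *
      ln_ennreal (\<integral>\<^sup>+x. renyi_integrand a (cell_density S P \<P> x) (cell_density S Q \<P> x) \<partial>S)"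
proof -
  note \<P> = finite_measurable_partitionsD[OF \<P>]
  define F where "F = sigma (space S) \<P>"
  have subS: "subalgebra S F" unfolding F_def using \<P>(2) by (rule subalgebra_sigma_partition)
  then have subP: "subalgebra P F" and subQ: "subalgebra Q F"
    by (simp_all add: subalgebra_def sets_P sets_Q space_P space_Q)
  have m [measurable]: "cell_density S N \<P> \<in> borel_measurable F" for N
    unfolding F_def by (rule measurable_cell_density_sigma) fact
  have "measure P A = 0" "measure Q A = 0" if "A \<in> \<P>" "measure S A = 0" for A
    using that \<P>(2) by (auto intro: measure_P_eq_0 measure_Q_eq_0)
  then have P: "restr_to_subalg P F
      = density (restr_to_subalg S F) (\<lambda>x. ennreal (cell_density S P \<P> x))"
    and Q: "restr_to_subalg Q F
      = density (restr_to_subalg S F) (\<lambda>x. ennreal (cell_density S Q \<P> x))"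
    unfolding F_def using \<P>
    by (auto intro!: restr_to_subalg_partition_eq_density S.finite_measure_axioms
        P.finite_measure_axioms Q.finite_measure_axioms sets_P sets_Q)
  have "renyi_divergence_simple a (restr_to_subalg P F) (restr_to_subalg Q F)
      = renyi_divergence_density a (restr_to_subalg S F) (cell_density S P \<P>) (cell_density S Q \<P>)"
    by (rule renyi_divergence_simple_eq_density[OF _ _ _ _ _ _ _ P Q])
      (use a subS subP subQ in \<open>auto intro!: prob_space_restr_to_subalg P.prob_space_axioms
        Q.prob_space_axioms finite_measure.axioms(1) finite_measure_restr_to_subalg
        S.finite_measure_axioms measurable_in_subalg m simp: cell_density_nonneg\<close>)
  also have "\<dots> = ereal (1 / (a - 1)) *
      ln_ennreal (\<integral>\<^sup>+x. renyi_integrand a (cell_density S P \<P> x) (cell_density S Q \<P> x) \<partial>S)"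
    unfolding renyi_divergence_density_def
    by (subst nn_integral_subalgebra2[OF subS]) measurable
  finally show ?thesis
    by (simp add: restrict_to_partition_def F_def space_P space_Q)
qed

text \<open>The integrand is constant on each cell, and homogeneity of degree 1
  (\<open>renyi_integrand_scale\<close>) absorbs the factor \<open>measure S A\<close>.\<close>

lemma nn_integral_step_eq_sum:
  assumes a: "a > 0" "a \<noteq> 1" and \<P>: "\<P> \<in> finite_measurable_partitions P"
  shows "(\<integral>\<^sup>+x. renyi_integrand a (cell_density S P \<P> x) (cell_density S Q \<P> x) \<partial>S)
    = (\<Sum>A\<in>\<P>. renyi_integrand a (measure P A) (measure Q A))"
proof -
  note \<P> = finite_measurable_partitionsD[OF \<P>]
  have [measurable]: "cell_density S N \<P> \<in> borel_measurable S" for N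
    by (rule measurable_from_subalg[OF subalgebra_sigma_partition[OF \<P>(2)]])
      (rule measurable_cell_density_sigma[OF \<P>(2)])
  have "(\<integral>\<^sup>+x. renyi_integrand a (cell_density S P \<P> x) (cell_density S Q \<P> x) * indicator A x \<partial>S)
      = renyi_integrand a (measure P A) (measure Q A)" if A: "A \<in> \<P>" for A
  proof -
    have AS: "A \<in> sets S" using A \<P> by auto
    have "(\<integral>\<^sup>+x. renyi_integrand a (cell_density S P \<P> x) (cell_density S Q \<P> x) * indicator A x \<partial>S)
      = (\<integral>\<^sup>+x. renyi_integrand a (measure P A / measure S A) (measure Q A / measure S A)
          * indicator A x \<partial>S)"
      using cell_density_eq[OF \<P>(1,3) A]
      by (intro nn_integral_cong) (auto split: split_indicator)
    also have "\<dots> = renyi_integrand a (measure P A / measure S A) (measure Q A / measure S A)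
        * ennreal (measure S A)"
      using AS by (simp add: nn_integral_cmult_indicator S.emeasure_eq_measure)
    also have "\<dots> = renyi_integrand a (measure P A) (measure Q A)"
    \<comment> \<open>Scaling needs a positive factor; on a null cell both sides are 0.\<close>
    proof (cases "measure S A = 0")
      case True
      then have "measure P A = 0" using AS by (rule measure_P_eq_0[rotated])
      then show ?thesis using True by simp
    next
      case False
      then show ?thesis
        using a renyi_integrand_scale[of "measure P A" "measure Q A" "measure S A" a]
        by (simp add: mult.commute less_le)
    qed
    finally show ?thesis .
  qed
  then show ?thesis
    by (subst nn_integral_partition[OF \<P>]) auto
qed

text \<open>The integrand vanishes at \<open>(0, 0)\<close>, so the indicator can move into both
  arguments. Each cell integral then has the shape of the Hoelder lemmas.\<close>

lemma renyi_integral_eq_sum: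
  assumes \<P>: "\<P> \<in> finite_measurable_partitions P"
  shows "renyi_integral a =
    (\<Sum>A\<in>\<P>. \<integral>\<^sup>+x. renyi_integrand a (f x * indicator A x) ((1 - f x) * indicator A x) \<partial>S)"
  unfolding renyi_integral_def
  by (subst nn_integral_partition[OF finite_measurable_partitionsD[OF \<P>]])
    (auto intro!: sum.cong nn_integral_cong split: split_indicator)

lemma nn_integral_cell:
  assumes "A \<in> sets S"
  shows "(\<integral>\<^sup>+x. ennreal (f x * indicator A x) \<partial>S) = ennreal (measure P A)"
    and "(\<integral>\<^sup>+x. ennreal ((1 - f x) * indicator A x) \<partial>S) = ennreal (measure Q A)"
  using emeasure_P[OF assms] emeasure_Q[OF assms]
  by (simp_all add: P.emeasure_eq_measure Q.emeasure_eq_measure indicator_mult_ennreal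
      ennreal_mult' ennreal_indicator f_nonneg f_le_1)

lemma renyi_integral_le_sum:
  assumes a: "0 < a" "a < 1" and \<P>: "\<P> \<in> finite_measurable_partitions P"
  shows "renyi_integral a \<le> (\<Sum>A\<in>\<P>. renyi_integrand a (measure P A) (measure Q A))"
  unfolding renyi_integral_eq_sum[OF \<P>]
proof (rule sum_mono)
  fix A assume "A \<in> \<P>"
  then have [measurable]: "A \<in> sets S" using finite_measurable_partitionsD[OF \<P>] by auto
  show "(\<integral>\<^sup>+x. renyi_integrand a (f x * indicator A x) ((1 - f x) * indicator A x) \<partial>S)
      \<le> renyi_integrand a (measure P A) (measure Q A)"
    by (rule nn_integral_renyi_integrand_le[OF a])
      (simp_all add: nn_integral_cell f_nonneg f_le_1)
qed

lemma renyi_integral_ge_sum: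
  assumes a: "1 < a" and \<P>: "\<P> \<in> finite_measurable_partitions P"
  shows "renyi_integral a \<ge> (\<Sum>A\<in>\<P>. renyi_integrand a (measure P A) (measure Q A))"
  unfolding renyi_integral_eq_sum[OF \<P>]
proof (rule sum_mono)
  fix A assume "A \<in> \<P>"
  then have [measurable]: "A \<in> sets S" using finite_measurable_partitionsD[OF \<P>] by auto
  show "(\<integral>\<^sup>+x. renyi_integrand a (f x * indicator A x) ((1 - f x) * indicator A x) \<partial>S)
      \<ge> renyi_integrand a (measure P A) (measure Q A)"
    by (rule nn_integral_renyi_integrand_ge[OF a])
      (simp_all add: nn_integral_cell f_nonneg f_le_1)
qed

lemma renyi_divergence_simple_partition:
  assumes "a > 0" "a \<noteq> 1" "\<P> \<in> finite_measurable_partitions P"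
  shows "renyi_divergence_simple a (restrict_to_partition P \<P>) (restrict_to_partition Q \<P>)
    = ereal (1 / (a - 1)) *
      ln_ennreal (\<Sum>A\<in>\<P>. renyi_integrand a (measure P A) (measure Q A))"
  using assms by (simp add: renyi_divergence_simple_partition_eq_step nn_integral_step_eq_sum)

text \<open>The data processing inequality for partitions. Below order 1 the sum over cells
  dominates the integral, and the negative factor \<open>1 / (a - 1)\<close> reverses this; above
  order 1 both signs change.\<close>

lemma renyi_divergence_simple_partition_le:
  assumes a: "a > 0" "a \<noteq> 1" and \<P>: "\<P> \<in> finite_measurable_partitions P"
  shows "renyi_divergence_simple a (restrict_to_partition P \<P>) (restrict_to_partition Q \<P>)
    \<le> renyi_divergence_simple a P Q"
proof (cases "a < 1")
  case True
  then show ?thesis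
    unfolding renyi_divergence_simple_partition[OF assms] renyi_divergence_simple_eq[OF a]
    using a \<P> by (intro cmult_ln_ennreal_antimono renyi_integral_le_sum)
next
  case False
  then show ?thesis
    unfolding renyi_divergence_simple_partition[OF assms] renyi_divergence_simple_eq[OF a]
    using a \<P> by (intro cmult_ln_ennreal_mono renyi_integral_ge_sum) auto
qed

end

subsection \<open>Approximation by partitions into level sets\<close>

text \<open>For \<open>a > 1\<close> the quotient is a product with an inverse, and the inverse on
  \<open>ennreal\<close> is continuous even at 0. The assumption \<open>ne\<close> rules out the one
  indeterminate product, 0 times infinity.\<close>

lemma tendsto_renyi_integrand:
  assumes a: "a > 0" "a \<noteq> 1" and u: "(u \<longlongrightarrow> l) F" and v: "(v \<longlongrightarrow> m) F"
    and nonneg: "eventually (\<lambda>x. u x \<ge> 0) F" "eventually (\<lambda>x. v x \<ge> 0) F"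
    and ne: "l \<noteq> 0 \<or> m \<noteq> 0"
  shows "((\<lambda>x. renyi_integrand a (u x) (v x)) \<longlongrightarrow> renyi_integrand a l m) F"
proof (cases "a < 1")
  case True
  have "((\<lambda>x. u x powr a * v x powr (1 - a)) \<longlongrightarrow> l powr a * m powr (1 - a)) F"
    using True a nonneg by (intro tendsto_mult tendsto_powr' u v tendsto_const) auto
  then show ?thesis using True by (simp add: renyi_integrand_def)
next
  case False
  then have "((\<lambda>x. ennreal (u x powr a)) \<longlongrightarrow> ennreal (l powr a)) F"
    and "((\<lambda>x. ennreal (v x powr (a - 1))) \<longlongrightarrow> ennreal (m powr (a - 1))) F"
    using a nonneg by (intro tendsto_ennrealI tendsto_powr' u v tendsto_const; simp)+
  moreover have inv: "continuous_on UNIV (\<lambda>y::ennreal. inverse y)"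
    by (intro continuous_on_inverse_ennreal continuous_on_id)
  have "((\<lambda>x. inverse (ennreal (v x powr (a - 1)))) \<longlongrightarrow> inverse (ennreal (m powr (a - 1)))) F"
    using calculation(2) by (rule continuous_on_tendsto_compose[OF inv]) auto
  ultimately have "((\<lambda>x. ennreal (u x powr a) * inverse (ennreal (v x powr (a - 1)))) \<longlongrightarrow>
      ennreal (l powr a) * inverse (ennreal (m powr (a - 1)))) F"
    using ne by (intro tendsto_mult_ennreal) (auto simp: ennreal_inverse_eq_0_iff)
  then show ?thesis using False by (simp add: renyi_integrand_def divide_ennreal_def)
qed

context mixture_density
begin

definition level_set :: "nat \<Rightarrow> nat \<Rightarrow> 'a set" where
  "level_set n k = {x \<in> space S. \<lfloor>real (Suc n) * f x\<rfloor> = int k}"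

text \<open>The index \<open>Suc n\<close> is included for the points with \<open>f x = 1\<close>.
  Empty level sets are removed because \<open>partition_on\<close> forbids empty cells.\<close>

definition level_partition :: "nat \<Rightarrow> 'a set set" where
  "level_partition n = level_set n ` {..Suc n} - {{}}"

lemma level_set_in_sets [measurable]: "level_set n k \<in> sets S"
  unfolding level_set_def by measurable

lemma level_partition_in_finite_measurable_partitions:
  "level_partition n \<in> finite_measurable_partitions P"
proof -
  have "x \<in> \<Union>(level_partition n)" if x: "x \<in> space S" for x
  proof -
    let ?k = "\<lfloor>real (Suc n) * f x\<rfloor>"
    have "real (Suc n) * f x \<le> real (Suc n)"
      using f_le_1[of x] f_nonneg[of x] by (intro mult_left_le) auto
    then have "?k \<le> int (Suc n)"
      using floor_mono by (metis floor_of_nat)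
    moreover have "0 \<le> ?k" using f_nonneg[of x] by simp
    ultimately have "x \<in> level_set n (nat ?k)" "nat ?k \<in> {..Suc n}"
      using x by (auto simp: level_set_def nat_le_iff simp del: of_nat_Suc)
    then show ?thesis unfolding level_partition_def by blast
  qed
  moreover have "\<Union>(level_partition n) \<subseteq> space S"
    by (auto simp: level_partition_def level_set_def)
  moreover have "disjoint (level_partition n)"
    by (auto simp: disjoint_def level_partition_def level_set_def)
  ultimately show ?thesis
    by (auto simp: finite_measurable_partitions_def partition_on_def space_P sets_P
        level_partition_def)
qed

lemma level_set_measure_bounds:
  fixes n k :: nat
  defines "A \<equiv> level_set n k"
  shows "real k / real (Suc n) * measure S A \<le> measure P A"
    and "measure P A \<le> (real k + 1) / real (Suc n) * measure S A"
proof -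
  have A [measurable]: "A \<in> sets S" by (simp add: A_def)
  have bounds: "real k / real (Suc n) \<le> f x" "f x \<le> (real k + 1) / real (Suc n)" if "x \<in> A" for x
    using that by (auto simp: A_def level_set_def floor_eq_iff field_simps)
  have int: "(\<integral>\<^sup>+x. ennreal c * indicator A x \<partial>S) = ennreal (c * measure S A)" if "c \<ge> 0" for c
    using that by (simp add: nn_integral_cmult_indicator S.emeasure_eq_measure ennreal_mult)
  have "ennreal (real k / real (Suc n) * measure S A) \<le> emeasure P A"
    unfolding emeasure_P[OF A] using bounds
    by (subst int[symmetric])
      (auto intro!: nn_integral_mono ennreal_leI split: split_indicator simp del: of_nat_Suc)
  then show "real k / real (Suc n) * measure S A \<le> measure P A"
    by (simp add: P.emeasure_eq_measure del: of_nat_Suc)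
  have "emeasure P A \<le> ennreal ((real k + 1) / real (Suc n) * measure S A)"
    unfolding emeasure_P[OF A] using bounds
    by (subst int[symmetric])
      (auto intro!: nn_integral_mono ennreal_leI split: split_indicator simp del: of_nat_Suc)
  then show "measure P A \<le> (real k + 1) / real (Suc n) * measure S A"
    by (simp add: P.emeasure_eq_measure ennreal_le_iff del: of_nat_Suc)
qed

text \<open>On a cell of positive measure both \<open>f\<close> and its average lie in the same
  interval of length \<open>1 / Suc n\<close>. Null cells are excepted: there both cell densities
  are 0 and do not add up to 1.\<close>

lemma AE_cell_density_level_partition:
  "AE x in S. \<bar>cell_density S P (level_partition n) x - f x\<bar> \<le> 1 / real (Suc n) \<and>
    cell_density S P (level_partition n) x + cell_density S Q (level_partition n) x = 1"
proof -
  note part = finite_measurable_partitionsD[OF level_partition_in_finite_measurable_partitions[of n]]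
  have "AE x in S. \<forall>A\<in>level_partition n. x \<in> A \<longrightarrow> measure S A \<noteq> 0"
  proof (rule AE_finite_allI)
    fix A assume "A \<in> level_partition n"
    then have A: "A \<in> sets S" using part by auto
    show "AE x in S. x \<in> A \<longrightarrow> measure S A \<noteq> 0"
    proof (cases "measure S A = 0")
      case True
      then have "A \<in> null_sets S" using A by (auto simp: null_sets_def S.emeasure_eq_measure)
      then show ?thesis by (rule AE_I') auto
    qed simp
  qed (rule part)
  then show ?thesis
    using AE_space
  proof eventually_elim
    case (elim x)
    then obtain A where A: "A \<in> level_partition n" "x \<in> A"
      using part(3) by (auto simp: partition_on_def)
    then have "measure S A \<noteq> 0" using elim by auto
    then have pos: "measure S A > 0" by (simp add: less_le)
    obtain k where k: "A = level_set n k" using A by (auto simp: level_partition_def)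
    have P: "cell_density S P (level_partition n) x = measure P A / measure S A"
      and Q: "cell_density S Q (level_partition n) x = measure Q A / measure S A"
      using A part by (auto intro: cell_density_eq)
    have sum: "measure P A / measure S A + measure Q A / measure S A = 1"
      using measure_add[of A] A part pos by (auto simp flip: add_divide_distrib)
    have "real k / real (Suc n) \<le> measure P A / measure S A"
      "measure P A / measure S A \<le> (real k + 1) / real (Suc n)"
      using level_set_measure_bounds[where n = n and k = k] pos unfolding k
      by (simp_all add: pos_le_divide_eq pos_divide_le_eq del: of_nat_Suc)
    moreover have "real k / real (Suc n) \<le> f x" "f x \<le> (real k + 1) / real (Suc n)"
      using A(2) unfolding k by (auto simp: level_set_def floor_eq_iff field_simps)
    ultimately have "\<bar>measure P A / measure S A - f x\<bar> \<le> 1 / real (Suc n)"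
      by (simp add: add_divide_distrib del: of_nat_Suc)
    then show ?case unfolding P Q using sum by blast
  qed
qed

lemma AE_tendsto_renyi_integrand_level_partition:
  assumes a: "a > 0" "a \<noteq> 1"
  shows "AE x in S. (\<lambda>n. renyi_integrand a (cell_density S P (level_partition n) x)
      (cell_density S Q (level_partition n) x)) \<longlonglongrightarrow> renyi_integrand a (f x) (1 - f x)"
proof -
  have "AE x in S. \<forall>n. \<bar>cell_density S P (level_partition n) x - f x\<bar> \<le> 1 / real (Suc n) \<and>
    cell_density S P (level_partition n) x + cell_density S Q (level_partition n) x = 1"
    using AE_cell_density_level_partition by (simp add: AE_all_countable)
  then show ?thesis
  proof eventually_elim
    case (elim x)
    let ?u = "\<lambda>n. cell_density S P (level_partition n) x"
    let ?v = "\<lambda>n. cell_density S Q (level_partition n) x"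
    have "(\<lambda>n. ?u n - f x) \<longlonglongrightarrow> 0"
      using elim by (intro Lim_null_comparison[OF _ LIMSEQ_inverse_real_of_nat])
        (auto simp: inverse_eq_divide)
    then have u: "?u \<longlonglongrightarrow> f x" by (simp add: LIM_zero_iff)
    \<comment> \<open>Convergence of \<open>?v\<close> comes from that of \<open>?u\<close>; the
      limits add up to 1, so they are not both 0.\<close>
    have "?v = (\<lambda>n. 1 - ?u n)"
    proof
      fix n show "?v n = 1 - ?u n" using elim[rule_format, of n] by linarith
    qed
    then have v: "?v \<longlonglongrightarrow> 1 - f x" using u by (auto intro!: tendsto_intros)
    show ?case
      using a u v by (rule tendsto_renyi_integrand) (auto simp: cell_density_nonneg)
  qed
qed

lemma measurable_cell_density_level_partition [measurable]:
  "cell_density S N (level_partition n) \<in> borel_measurable S"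
proof -
  note sub = finite_measurable_partitionsD(2)[OF level_partition_in_finite_measurable_partitions]
  show ?thesis
    by (rule measurable_from_subalg[OF subalgebra_sigma_partition[OF sub]])
      (rule measurable_cell_density_sigma[OF sub])
qed

lemma tendsto_renyi_integral_level_partition:
  assumes a: "a > 0" "a \<noteq> 1"
  shows "(\<lambda>n. \<integral>\<^sup>+x. renyi_integrand a (cell_density S P (level_partition n) x)
      (cell_density S Q (level_partition n) x) \<partial>S) \<longlonglongrightarrow> renyi_integral a" (is "?I \<longlonglongrightarrow> _")
proof (cases "a < 1")
  case True
  show ?thesis
    unfolding renyi_integral_def
  \<comment> \<open>The constant 1 is integrable because \<open>S\<close> is finite, and it
    dominates because the cell densities are nonnegative with sum 1.\<close>
  proof (rule nn_integral_dominated_convergence[where w = "\<lambda>_. 1"])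
    fix n
    show "AE x in S. renyi_integrand a (cell_density S P (level_partition n) x)
        (cell_density S Q (level_partition n) x) \<le> 1"
      using AE_cell_density_level_partition[of n]
    proof eventually_elim
      case (elim x)
      let ?u = "cell_density S P (level_partition n) x"
      let ?v = "cell_density S Q (level_partition n) x"
      have "?u powr a \<le> 1" "?v powr (1 - a) \<le> 1"
        using elim a True cell_density_nonneg[of S P "level_partition n" x]
          cell_density_nonneg[of S Q "level_partition n" x] by (auto intro!: powr_le1)
      then have "?u powr a * ?v powr (1 - a) \<le> 1 * 1" by (intro mult_mono) auto
      then show ?case using True by (simp add: renyi_integrand_def)
    qed
    show "AE x in S. (\<lambda>n. renyi_integrand a (cell_density S P (level_partition n) x)
      (cell_density S Q (level_partition n) x)) \<longlonglongrightarrow> renyi_integrand a (f x) (1 - f x)"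
      using a by (rule AE_tendsto_renyi_integrand_level_partition)
  qed (auto simp: less_top[symmetric])
next
  case False
  then have a1: "a > 1" using a by simp
  let ?r = "\<lambda>n x. renyi_integrand a (cell_density S P (level_partition n) x)
      (cell_density S Q (level_partition n) x)"
  \<comment> \<open>Fatou's lemma bounds only the lower limit; the upper limit is controlled by
    Hoelder's inequality on the cells.\<close>
  have le: "?I n \<le> renyi_integral a" for n
    using renyi_integral_ge_sum[OF a1] level_partition_in_finite_measurable_partitions a
    by (subst nn_integral_step_eq_sum) auto
  have "renyi_integral a = (\<integral>\<^sup>+x. liminf (\<lambda>n. ?r n x) \<partial>S)"
    unfolding renyi_integral_def
  proof (rule nn_integral_cong_AE, use AE_tendsto_renyi_integrand_level_partition[OF a] in eventually_elim)
    case (elim x)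
    then show ?case by (simp add: lim_imp_Liminf)
  qed
  also have "\<dots> \<le> liminf ?I" by (rule nn_integral_liminf) measurable
  finally have ge: "renyi_integral a \<le> liminf ?I" .
  have "limsup ?I \<le> renyi_integral a" using le by (intro Limsup_bounded) auto
  moreover have "liminf ?I \<le> limsup ?I" by (rule Liminf_le_Limsup) simp
  ultimately show ?thesis
    using ge by (intro Liminf_eq_Limsup) auto
qed

lemma renyi_divergence_simple_eq_SUP:
  assumes a: "a > 0" "a \<noteq> 1"
  shows "renyi_divergence_simple a P Q = (SUP \<P> \<in> finite_measurable_partitions P.
    renyi_divergence_simple a (restrict_to_partition P \<P>) (restrict_to_partition Q \<P>))"
proof (rule antisym)
  let ?D = "\<lambda>\<P>. renyi_divergence_simple a (restrict_to_partition P \<P>) (restrict_to_partition Q \<P>)"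
  have "(\<lambda>n. ?D (level_partition n)) \<longlonglongrightarrow> renyi_divergence_simple a P Q"
    unfolding renyi_divergence_simple_eq[OF a]
      renyi_divergence_simple_partition_eq_step[OF a level_partition_in_finite_measurable_partitions]
    using a by (intro tendsto_cmult_ereal tendsto_ln_ennreal tendsto_renyi_integral_level_partition) auto
  then show "renyi_divergence_simple a P Q \<le> (SUP \<P> \<in> finite_measurable_partitions P. ?D \<P>)"
    by (rule LIMSEQ_le_const2)
      (intro exI allI impI SUP_upper level_partition_in_finite_measurable_partitions)
  show "(SUP \<P> \<in> finite_measurable_partitions P. ?D \<P>) \<le> renyi_divergence_simple a P Q"
    using a by (intro SUP_least renyi_divergence_simple_partition_le)
qed

subsection \<open>Order zero\<close>

text \<open>The second set is empty when \<open>f\<close> has no zeros, hence the removal of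
  \<open>{}\<close>.\<close>

definition support_partition :: "'a set set" where
  "support_partition = {{x \<in> space S. f x \<noteq> 0}, {x \<in> space S. f x = 0}} - {{}}"

lemma support_partition_in_finite_measurable_partitions:
  "support_partition \<in> finite_measurable_partitions P"
proof -
  have "\<Union>support_partition = space S" "disjoint support_partition"
    by (auto simp: support_partition_def disjoint_def)
  moreover have "support_partition \<subseteq> sets S"
    unfolding support_partition_def by auto
  ultimately show ?thesis
    by (auto simp: finite_measurable_partitions_def partition_on_def space_P sets_P
        support_partition_def)
qed

lemma emeasure_Q_support:
  "emeasure Q {x \<in> space S. f x \<noteq> 0} = (\<integral>\<^sup>+x. (if f x \<noteq> 0 then ennreal (1 - f x) else 0) \<partial>S)"
  by (subst emeasure_Q) (auto intro!: nn_integral_cong split: split_indicator)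

lemma sum_support_partition:
  assumes a: "0 < a" "a < 1"
  shows "(\<Sum>A\<in>support_partition. renyi_integrand a (measure P A) (measure Q A))
    = ennreal (measure Q {x \<in> space S. f x \<noteq> 0} powr (1 - a))"
proof -
  let ?A = "{x \<in> space S. f x \<noteq> 0}" and ?B = "{x \<in> space S. f x = 0}"
  have A: "?A \<in> sets S" and B: "?B \<in> sets S" by measurable
  have "emeasure P ?B = (\<integral>\<^sup>+x. 0 \<partial>S)"
    unfolding emeasure_P[OF B] by (intro nn_integral_cong) (auto split: split_indicator)
  then have PB: "measure P ?B = 0" by (simp add: P.emeasure_eq_measure)
  have "?A \<union> ?B = space P" by (auto simp: space_P)
  moreover have "measure P (?A \<union> ?B) = measure P ?A + measure P ?B"
    using A B by (intro P.finite_measure_Union) (auto simp: sets_P)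
  ultimately have PA: "measure P ?A = 1" using PB P.prob_space by simp
  \<comment> \<open>The support survives the removal of \<open>{}\<close> and differs from its
    complement, so its term is counted once; the term of \<open>?B\<close>, if present, is
    0.\<close>
  then have "?A \<noteq> {}" by (metis measure_empty zero_neq_one)
  moreover then have "?A \<noteq> ?B" by auto
  ultimately have "(\<Sum>A\<in>support_partition. renyi_integrand a (measure P A) (measure Q A))
      = renyi_integrand a (measure P ?A) (measure Q ?A)"
    using PB by (cases "?B = {}") (auto simp: support_partition_def insert_Diff_if)
  then show ?thesis using a PA by (simp add: renyi_integrand_def)
qed

text \<open>The exponent \<open>1 - a\<close> cancels against \<open>1 / (a - 1)\<close>, so the
  value is the same for every order in (0,1), and an infimum over orders costs nothing.\<close>

lemma renyi_divergence_simple_support_partition: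
  assumes a: "0 < a" "a < 1"
  shows "renyi_divergence_simple a (restrict_to_partition P support_partition)
      (restrict_to_partition Q support_partition)
    = - ln_ennreal (emeasure Q {x \<in> space S. f x \<noteq> 0})"
proof -
  let ?q = "measure Q {x \<in> space S. f x \<noteq> 0}"
  have "renyi_divergence_simple a (restrict_to_partition P support_partition)
      (restrict_to_partition Q support_partition)
    = ereal (1 / (a - 1)) * ln_ennreal (ennreal (?q powr (1 - a)))"
    using a support_partition_in_finite_measurable_partitions
    by (subst renyi_divergence_simple_partition) (auto simp: sum_support_partition)
  also have "\<dots> = - ln_ennreal (ennreal ?q)"
  proof (cases "?q = 0")
    case True
    then show ?thesis using a by simp
  next
    case False
    then have "?q > 0" by (simp add: less_le)
    moreover have "1 / (a - 1) * ((1 - a) * ln ?q) = - ln ?q"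
      using a by (simp add: field_simps)
    ultimately show ?thesis using a by (simp add: ln_ennreal_ennreal ln_powr)
  qed
  finally show ?thesis by (simp add: Q.emeasure_eq_measure)
qed

text \<open>As the order tends to 0, \<open>f x powr a\<close> tends to 1 where
  \<open>f x > 0\<close> and stays 0 elsewhere. By dominated convergence the integral tends to the
  \<open>Q\<close>-mass of the support, and the infimum lies below the limit of the
  divergences.\<close>

lemma INF_renyi_divergence_simple_le:
  "(INF a\<in>{0<..<1}. renyi_divergence_simple a P Q) \<le> - ln_ennreal (emeasure Q {x \<in> space S. f x \<noteq> 0})"
proof -
  \<comment> \<open>The shift by 2 keeps every order strictly below 1.\<close>
  define a :: "nat \<Rightarrow> real" where "a n = 1 / real (n + 2)" for n
  have a: "0 < a n" "a n < 1" for n by (auto simp: a_def)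
  have a0: "a \<longlonglongrightarrow> 0" unfolding a_def by real_asymp
  have "(\<lambda>n. renyi_integral (a n)) \<longlonglongrightarrow> (\<integral>\<^sup>+x. (if f x \<noteq> 0 then ennreal (1 - f x) else 0) \<partial>S)"
    unfolding renyi_integral_def
  proof (rule nn_integral_dominated_convergence[where w = "\<lambda>_. 1"])
    fix n
    have "f x powr a n * (1 - f x) powr (1 - a n) \<le> 1 * 1" for x
      using a[of n] f_nonneg[of x] f_le_1[of x] by (intro mult_mono powr_le1) auto
    then show "AE x in S. renyi_integrand (a n) (f x) (1 - f x) \<le> 1"
      using a by (simp add: renyi_integrand_def)
  next
    show "AE x in S. (\<lambda>n. renyi_integrand (a n) (f x) (1 - f x))
        \<longlonglongrightarrow> (if f x \<noteq> 0 then ennreal (1 - f x) else 0)"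
    proof (rule AE_I2)
      fix x
      have "(\<lambda>n. ennreal (f x powr a n * (1 - f x) powr (1 - a n)))
          \<longlonglongrightarrow> ennreal (f x powr 0 * (1 - f x) powr (1 - 0))" if "f x \<noteq> 0"
        using that f_le_1[of x]
        by (intro tendsto_ennrealI tendsto_mult tendsto_powr' tendsto_diff tendsto_const a0) auto
      then show "(\<lambda>n. renyi_integrand (a n) (f x) (1 - f x))
          \<longlonglongrightarrow> (if f x \<noteq> 0 then ennreal (1 - f x) else 0)"
        using a f_nonneg[of x] f_le_1[of x] by (auto simp: renyi_integrand_def)
    qed
  qed (auto simp: less_top[symmetric])
  then have "(\<lambda>n. ln_ennreal (renyi_integral (a n)))
      \<longlonglongrightarrow> ln_ennreal (emeasure Q {x \<in> space S. f x \<noteq> 0})"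
    unfolding emeasure_Q_support by (rule tendsto_ln_ennreal)
  moreover have "(\<lambda>n. 1 / (a n - 1)) \<longlonglongrightarrow> 1 / (0 - 1)"
    by (intro tendsto_intros a0) auto
  then have "(\<lambda>n. ereal (1 / (a n - 1))) \<longlonglongrightarrow> ereal (- 1)" by simp
  ultimately have "(\<lambda>n. ereal (1 / (a n - 1)) * ln_ennreal (renyi_integral (a n)))
      \<longlonglongrightarrow> ereal (- 1) * ln_ennreal (emeasure Q {x \<in> space S. f x \<noteq> 0})"
    by (intro tendsto_mult_ereal) auto
  moreover have "ereal (1 / (a n - 1)) * ln_ennreal (renyi_integral (a n))
      = renyi_divergence_simple (a n) P Q" for n
    using a[of n] by (subst renyi_divergence_simple_eq) auto
  ultimately have "(\<lambda>n. renyi_divergence_simple (a n) P Q)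
      \<longlonglongrightarrow> - ln_ennreal (emeasure Q {x \<in> space S. f x \<noteq> 0})"
    by (simp add: uminus_ereal.simps(1)[symmetric] del: uminus_ereal.simps)
  then show ?thesis
    by (rule LIMSEQ_le_const) (use a in \<open>auto intro!: INF_lower\<close>)
qed

lemma prob_space_restrict_to_partition:
  assumes "\<P> \<in> finite_measurable_partitions P"
  shows "prob_space (restrict_to_partition P \<P>)" "prob_space (restrict_to_partition Q \<P>)"
    and "sets (restrict_to_partition P \<P>) = sets (restrict_to_partition Q \<P>)"
proof -
  note \<P> = finite_measurable_partitionsD(2)[OF assms]
  have sub: "subalgebra P (sigma (space P) \<P>)" "subalgebra Q (sigma (space Q) \<P>)"
    using \<P> by (auto intro!: subalgebra_sigma_partition simp: sets_P sets_Q)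
  then show "prob_space (restrict_to_partition P \<P>)" "prob_space (restrict_to_partition Q \<P>)"
    unfolding restrict_to_partition_def
    by (auto intro: prob_space_restr_to_subalg P.prob_space_axioms Q.prob_space_axioms)
  show "sets (restrict_to_partition P \<P>) = sets (restrict_to_partition Q \<P>)"
    unfolding restrict_to_partition_def sub[THEN sets_restr_to_subalg] by (simp add: space_P space_Q)
qed

lemma renyi_divergence_0_eq_SUP_partitions:
  "renyi_divergence 0 P Q = (SUP \<P> \<in> finite_measurable_partitions P.
     renyi_divergence 0 (restrict_to_partition P \<P>) (restrict_to_partition Q \<P>))"
proof -
  let ?D = "\<lambda>a \<P>. renyi_divergence_simple a (restrict_to_partition P \<P>) (restrict_to_partition Q \<P>)"
  have "(INF a\<in>{0<..<1}. renyi_divergence_simple a P Q)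
      = (SUP \<P> \<in> finite_measurable_partitions P. INF a\<in>{0<..<1}. ?D a \<P>)"
  proof (rule antisym)
    have "(INF a\<in>{0<..<1}. renyi_divergence_simple a P Q)
        \<le> (INF a\<in>{0<..<1}. ?D a support_partition)"
      using INF_renyi_divergence_simple_le
      by (intro INF_greatest) (auto simp: renyi_divergence_simple_support_partition)
    also have "\<dots> \<le> (SUP \<P> \<in> finite_measurable_partitions P. INF a\<in>{0<..<1}. ?D a \<P>)"
      by (rule SUP_upper) (rule support_partition_in_finite_measurable_partitions)
    finally show "(INF a\<in>{0<..<1}. renyi_divergence_simple a P Q)
      \<le> (SUP \<P> \<in> finite_measurable_partitions P. INF a\<in>{0<..<1}. ?D a \<P>)" .
    show "(SUP \<P> \<in> finite_measurable_partitions P. INF a\<in>{0<..<1}. ?D a \<P>)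
      \<le> (INF a\<in>{0<..<1}. renyi_divergence_simple a P Q)"
      \<comment> \<open>At every order the restricted divergence is the smaller one, hence so is its
        infimum.\<close>
      by (intro SUP_least INF_mono) (auto intro!: bexI renyi_divergence_simple_partition_le)
  qed
  then show ?thesis
    by (simp add: renyi_divergence_0_eq_INF prob_space_restrict_to_partition
        P.prob_space_axioms Q.prob_space_axioms sets_P sets_Q cong: SUP_cong)
qed

end

section \<open>All orders together\<close>

theorem theorem10:
  fixes P Q :: "'a measure" and \<alpha> :: ennreal
  assumes "prob_space P" and "prob_space Q" and "sets P = sets Q"
  shows "renyi_divergence \<alpha> P Q =
    (SUP \<P> \<in> finite_measurable_partitions P.
       renyi_divergence \<alpha> (restrict_to_partition P \<P>) (restrict_to_partition Q \<P>))"
proof -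
  obtain S f where "mixture_density S P Q f"
    using assms by (rule mixture_density_exists)
  then interpret mixture_density S P Q f .
  let ?D = "\<lambda>a \<P>. renyi_divergence_simple a (restrict_to_partition P \<P>) (restrict_to_partition Q \<P>)"
  consider "\<alpha> = 0" | "\<alpha> = 1" | "\<alpha> = top" | "\<alpha> \<noteq> 0" "\<alpha> \<noteq> 1" "\<alpha> \<noteq> top" by blast
  then show ?thesis
  proof cases
    case 1
    then show ?thesis using renyi_divergence_0_eq_SUP_partitions by simp
  next
    case 2
    \<comment> \<open>Each simple order is expanded into a supremum over partitions; exchanging the
      two suprema leaves order 1 of the restrictions inside.\<close>
    have "renyi_divergence 1 P Q
        = (SUP a\<in>{0<..<1}. SUP \<P> \<in> finite_measurable_partitions P. ?D a \<P>)"
      unfolding renyi_divergence_1_eq_SUP[OF assms]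
      by (intro SUP_cong refl renyi_divergence_simple_eq_SUP) auto
    also have "\<dots> = (SUP \<P> \<in> finite_measurable_partitions P. SUP a\<in>{0<..<1}. ?D a \<P>)"
      by (rule SUP_commute)
    finally show ?thesis
      using 2 by (simp add: renyi_divergence_1_eq_SUP prob_space_restrict_to_partition cong: SUP_cong)
  next
    case 3
    have "renyi_divergence top P Q
        = (SUP a\<in>{1<..}. SUP \<P> \<in> finite_measurable_partitions P. ?D a \<P>)"
      unfolding renyi_divergence_top_eq_SUP[OF assms]
      by (intro SUP_cong refl renyi_divergence_simple_eq_SUP) auto
    also have "\<dots> = (SUP \<P> \<in> finite_measurable_partitions P. SUP a\<in>{1<..}. ?D a \<P>)"
      by (rule SUP_commute)
    finally show ?thesis
      using 3 by (simp add: renyi_divergence_top_eq_SUP prob_space_restrict_to_partition cong: SUP_cong)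
  next
    case 4
    then have "enn2real \<alpha> > 0" "enn2real \<alpha> \<noteq> 1"
      by (cases \<alpha>; auto simp: less_le)+
    then show ?thesis
      using 4 by (simp add: renyi_divergence_def renyi_divergence_simple_eq_SUP)
  qed
qed

end
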